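(* Let $\lambda\in\mathrm{Aut}(F_n)$ be a Nielsen transformation and let $\Phi:\mathrm{Aut}(F_n)\to\mathrm{SL}(d,\mathbb{R})$ be an arbitrary representation. If $n\ge 6$, then the eigenvalues of $\Phi(\lambda)$ all have modulus $1$.
   Context: $F_n$ is the free group of rank $n$ with a fixed basis $\{a_1,\dots,a_n\}$. The Nielsen transformations are the automorphisms, for $i\neq j$, $\lambda_{ij}: a_i\mapsto a_ja_i,\ a_k\mapsto a_k\ (k\ne i)$ and $\rho_{ij}: a_i\mapsto a_ia_j,\ a_k\mapsto a_k\ (k\neq i)$. Eigenvalues are complex eigenvalues. *)

theory Defs
  imports "HOL-Algebra.Bij" "Jordan_Normal_Form.Char_Poly"
begin

section \<open>Free groups as groups of reduced words\<close>

text \<open>A letter \<open>(x, True)\<close> stands for the generator \<open>x\<close>, and \<open>(x, False)\<close> for its inverse.\<close>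

type_synonym 'a letter = "'a \<times> bool"

definition inv_letter :: "'a letter \<Rightarrow> 'a letter" where
  "inv_letter l = (fst l, \<not> snd l)"

fun reduced :: "'a letter list \<Rightarrow> bool" where
  "reduced [] = True"
| "reduced [l] = True"
| "reduced (l # m # w) = (m \<noteq> inv_letter l \<and> reduced (m # w))"

fun cons_red :: "'a letter \<Rightarrow> 'a letter list \<Rightarrow> 'a letter list" where
  "cons_red l [] = [l]"
| "cons_red l (m # w) = (if m = inv_letter l then w else l # m # w)"

text \<open>Multiplication is concatenation followed by free reduction; for a reduced second factor the
  reduction is carried out by prepending the letters of the first factor one at a time, from right
  to left.\<close>

definition free_group :: "'a set \<Rightarrow> 'a letter list monoid" where
  "free_group X =
    \<lparr>carrier = {w. reduced w \<and> fst ` set w \<subseteq> X}, monoid.mult = foldr cons_red, one = []\<rparr>"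

definition gen :: "'a \<Rightarrow> 'a letter list" where
  "gen x = [(x, True)]"

lemma inv_letter_inv [simp]: "inv_letter (inv_letter l) = l"
  by (simp add: inv_letter_def)

lemma inv_letter_neq [simp]: "inv_letter l \<noteq> l" "l \<noteq> inv_letter l"
  by (cases l; simp add: inv_letter_def)+

lemma reduced_tl: "reduced (l # w) \<Longrightarrow> reduced w"
  by (cases w) auto

lemma reduced_cons_red: "reduced w \<Longrightarrow> reduced (cons_red l w)"
  by (cases w) (auto dest: reduced_tl)

lemma set_cons_red: "set (cons_red l w) \<subseteq> insert l (set w)"
  by (cases w) auto

lemma cons_red_inv: "reduced w \<Longrightarrow> cons_red l (cons_red (inv_letter l) w) = w"
  by (cases w rule: reduced.cases) auto

lemma cons_red_reduced: "reduced (l # w) \<Longrightarrow> cons_red l w = l # w"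
  by (cases w) auto

lemma reduced_foldr: "reduced w \<Longrightarrow> reduced (foldr cons_red u w)"
  by (induction u) (auto intro: reduced_cons_red)

lemma set_foldr: "set (foldr cons_red u w) \<subseteq> set u \<union> set w"
proof (induction u)
  case (Cons l u)
  then show ?case using set_cons_red[of l "foldr cons_red u w"] by auto
qed simp

lemma foldr_cons_red_Nil: "reduced w \<Longrightarrow> foldr cons_red w [] = w"
proof (induction w)
  case (Cons l w)
  then show ?case using reduced_tl[of l w] cons_red_reduced[of l w] by simp
qed simp

lemma foldr_cons_red_cons_red:
  "reduced w \<Longrightarrow> foldr cons_red (cons_red l u) w = cons_red l (foldr cons_red u w)"
  by (cases u) (auto simp: cons_red_inv reduced_foldr)

lemma foldr_cons_red_assoc:
  "reduced w \<Longrightarrow> foldr cons_red (foldr cons_red u v) w = foldr cons_red u (foldr cons_red v w)"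
  by (induction u) (auto simp: foldr_cons_red_cons_red)

lemma foldr_cons_red_left_inv:
  "reduced w \<Longrightarrow> foldr cons_red (rev (map inv_letter u)) (foldr cons_red u w) = w"
proof (induction u)
  case (Cons l u)
  then show ?case
    using cons_red_inv[of "foldr cons_red u w" "inv_letter l"] by (simp add: reduced_foldr)
qed simp

lemma group_free_group: "group (free_group X)"
proof (rule groupI)
  fix u assume u: "u \<in> carrier (free_group X)"
  define v where "v = foldr cons_red (rev (map inv_letter u)) []"
  have red: "reduced u" "fst ` set u \<subseteq> X" using u by (auto simp: free_group_def)
  have "set v \<subseteq> inv_letter ` set u"
    using set_foldr[of "rev (map inv_letter u)" "[]"] by (simp add: v_def)
  then have "fst ` set v \<subseteq> X" using red(2) by (fastforce simp: inv_letter_def)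
  then have "v \<in> carrier (free_group X)"
    by (simp add: free_group_def v_def reduced_foldr)
  moreover have "foldr cons_red v u = []"
    using foldr_cons_red_assoc[of u "rev (map inv_letter u)" "[]"]
      foldr_cons_red_left_inv[of "[]" u] red(1)
    by (simp add: v_def foldr_cons_red_Nil)
  ultimately show "\<exists>v\<in>carrier (free_group X).
      v \<otimes>\<^bsub>free_group X\<^esub> u = \<one>\<^bsub>free_group X\<^esub>"
    by (auto simp: free_group_def)
next
  fix u v
  assume "u \<in> carrier (free_group X)" "v \<in> carrier (free_group X)"
  then show "u \<otimes>\<^bsub>free_group X\<^esub> v \<in> carrier (free_group X)"
    using set_foldr[of u v] by (fastforce simp: free_group_def reduced_foldr)
qed (auto simp: free_group_def foldr_cons_red_assoc)

lemma gen_carrier: "x \<in> X \<Longrightarrow> gen x \<in> carrier (free_group X)"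
  by (simp add: gen_def free_group_def)

subsection \<open>Universal property\<close>

definition letter_val :: "('b, 'c) monoid_scheme \<Rightarrow> ('a \<Rightarrow> 'b) \<Rightarrow> 'a letter \<Rightarrow> 'b" where
  "letter_val G g l = (if snd l then g (fst l) else inv\<^bsub>G\<^esub> g (fst l))"

definition free_lift :: "('b, 'c) monoid_scheme \<Rightarrow> ('a \<Rightarrow> 'b) \<Rightarrow> 'a letter list \<Rightarrow> 'b" where
  "free_lift G g w = foldr (\<lambda>l y. letter_val G g l \<otimes>\<^bsub>G\<^esub> y) w \<one>\<^bsub>G\<^esub>"

context group
begin

lemma letter_val_closed:
  "g \<in> X \<rightarrow> carrier G \<Longrightarrow> fst l \<in> X \<Longrightarrow> letter_val G g l \<in> carrier G"
  by (auto simp: letter_val_def)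

lemma letter_val_inv:
  "g \<in> X \<rightarrow> carrier G \<Longrightarrow> fst l \<in> X \<Longrightarrow> letter_val G g (inv_letter l) = inv (letter_val G g l)"
  by (auto simp: letter_val_def inv_letter_def Pi_iff)

lemma free_lift_closed:
  "g \<in> X \<rightarrow> carrier G \<Longrightarrow> fst ` set w \<subseteq> X \<Longrightarrow> free_lift G g w \<in> carrier G"
  by (induction w) (auto simp: free_lift_def letter_val_closed[of g X])

lemma free_lift_cons_red:
  assumes "g \<in> X \<rightarrow> carrier G" "fst l \<in> X" "fst ` set w \<subseteq> X"
  shows "free_lift G g (cons_red l w) = letter_val G g l \<otimes> free_lift G g w"
proof (cases w)
  case (Cons m v)
  have v: "free_lift G g v \<in> carrier G" and l: "letter_val G g l \<in> carrier G"
    using assms Cons free_lift_closed[of g X v] letter_val_closed[of g X l] by auto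
  have "letter_val G g l \<otimes> (inv (letter_val G g l) \<otimes> free_lift G g v) = free_lift G g v"
    using v l by (simp add: m_assoc[symmetric])
  then show ?thesis
    using Cons letter_val_inv[OF assms(1,2)] by (auto simp: free_lift_def)
qed (simp add: free_lift_def)

lemma free_lift_mult:
  assumes "g \<in> X \<rightarrow> carrier G" "fst ` set u \<subseteq> X" "fst ` set w \<subseteq> X"
  shows "free_lift G g (foldr cons_red u w) = free_lift G g u \<otimes> free_lift G g w"
  using assms(2)
proof (induction u)
  case Nil
  then show ?case using free_lift_closed[OF assms(1,3)] by (simp add: free_lift_def)
next
  case (Cons l u)
  have "fst ` set (foldr cons_red u w) \<subseteq> X"
    using set_foldr[of u w] Cons.prems assms(3) by fastforce
  then have "free_lift G g (foldr cons_red (l # u) w)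
      = letter_val G g l \<otimes> (free_lift G g u \<otimes> free_lift G g w)"
    using Cons free_lift_cons_red[OF assms(1), of l] by simp
  moreover have "letter_val G g l \<in> carrier G" "free_lift G g u \<in> carrier G"
    "free_lift G g w \<in> carrier G"
    using Cons.prems letter_val_closed[OF assms(1), of l] free_lift_closed[OF assms(1)] assms(3)
    by auto
  ultimately show ?case by (simp add: free_lift_def m_assoc)
qed

lemma free_lift_hom: "g \<in> X \<rightarrow> carrier G \<Longrightarrow> free_lift G g \<in> hom (free_group X) G"
  using free_lift_closed[of g X] free_lift_mult[of g X] by (intro homI) (auto simp: free_group_def)

lemma free_lift_gen: "g x \<in> carrier G \<Longrightarrow> free_lift G g (gen x) = g x"
  by (simp add: free_lift_def gen_def letter_val_def)

lemma free_hom_eqI: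
  assumes "f \<in> hom (free_group X) G" "h \<in> hom (free_group X) G"
    and eq: "\<And>x. x \<in> X \<Longrightarrow> f (gen x) = h (gen x)"
    and "w \<in> carrier (free_group X)"
  shows "f w = h w"
  using assms(4)
proof (induction w)
  interpret F: group "free_group X" by (rule group_free_group)
  interpret f: group_hom "free_group X" G f
    using assms(1) by (simp add: group_hom_def group_hom_axioms_def group_axioms group_free_group)
  interpret h: group_hom "free_group X" G h
    using assms(2) by (simp add: group_hom_def group_hom_axioms_def group_axioms group_free_group)
  {
    case Nil
    then show ?case using f.hom_one h.hom_one by (simp add: free_group_def)
  next
    case (Cons l w)
    obtain x b where l: "l = (x, b)" by (cases l)
    have x: "x \<in> X" and w: "w \<in> carrier (free_group X)" and red: "reduced (l # w)"
      using Cons.prems l by (auto simp: free_group_def dest: reduced_tl)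
    have lc: "[l] \<in> carrier (free_group X)" using x l by (simp add: free_group_def)
    have "[(x, False)] \<otimes>\<^bsub>free_group X\<^esub> gen x = \<one>\<^bsub>free_group X\<^esub>"
      by (simp add: free_group_def gen_def inv_letter_def)
    moreover have "[(x, False)] \<in> carrier (free_group X)" using x by (simp add: free_group_def)
    ultimately have "[(x, False)] = inv\<^bsub>free_group X\<^esub> gen x"
      using F.inv_equality gen_carrier[OF x] by simp
    then have "f [l] = h [l]"
      using eq[OF x] l gen_carrier[OF x] f.hom_inv h.hom_inv by (cases b) (simp_all add: gen_def)
    moreover have "l # w = [l] \<otimes>\<^bsub>free_group X\<^esub> w"
      using cons_red_reduced[OF red] by (simp add: free_group_def)
    ultimately show ?case using f.hom_mult[OF lc w] h.hom_mult[OF lc w] Cons.IH[OF w] by simp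
  }
qed

end

section \<open>Nielsen transformations\<close>

abbreviation Fn :: "nat \<Rightarrow> nat letter list monoid" where
  "Fn n \<equiv> free_group {1..n}"

text \<open>An automorphism is determined by its values on the basis, so each of these two predicates
  is satisfied by at most one \<open>f\<close>; existence is shown below.\<close>

definition is_left_nielsen :: "nat \<Rightarrow> nat \<Rightarrow> nat \<Rightarrow> (nat letter list \<Rightarrow> nat letter list) \<Rightarrow> bool" where
  "is_left_nielsen n i j f \<longleftrightarrow>
    f \<in> carrier (AutoGroup (Fn n)) \<and>
    f (gen i) = gen j \<otimes>\<^bsub>Fn n\<^esub> gen i \<and> (\<forall>k\<in>{1..n} - {i}. f (gen k) = gen k)"

definition is_right_nielsen :: "nat \<Rightarrow> nat \<Rightarrow> nat \<Rightarrow> (nat letter list \<Rightarrow> nat letter list) \<Rightarrow> bool" where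
  "is_right_nielsen n i j f \<longleftrightarrow>
    f \<in> carrier (AutoGroup (Fn n)) \<and>
    f (gen i) = gen i \<otimes>\<^bsub>Fn n\<^esub> gen j \<and> (\<forall>k\<in>{1..n} - {i}. f (gen k) = gen k)"

definition nielsen :: "nat \<Rightarrow> (nat letter list \<Rightarrow> nat letter list) \<Rightarrow> bool" where
  "nielsen n f \<longleftrightarrow>
    (\<exists>i\<in>{1..n}. \<exists>j\<in>{1..n}. i \<noteq> j \<and> (is_left_nielsen n i j f \<or> is_right_nielsen n i j f))"

lemma free_lift_autoI:
  assumes g: "g \<in> X \<rightarrow> carrier (free_group X)" and h: "h \<in> X \<rightarrow> carrier (free_group X)"
    and gh: "\<And>x. x \<in> X \<Longrightarrow> free_lift (free_group X) g (h x) = gen x"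
    and hg: "\<And>x. x \<in> X \<Longrightarrow> free_lift (free_group X) h (g x) = gen x"
  shows "restrict (free_lift (free_group X) g) (carrier (free_group X))
    \<in> carrier (AutoGroup (free_group X))"
proof -
  interpret F: group "free_group X" by (rule group_free_group)
  let ?C = "carrier (free_group X)"
  let ?g = "free_lift (free_group X) g" and ?h = "free_lift (free_group X) h"
  have hom: "?g \<in> hom (free_group X) (free_group X)" "?h \<in> hom (free_group X) (free_group X)"
    using g h by (auto intro: F.free_lift_hom)
  have id: "(\<lambda>w. w) \<in> hom (free_group X) (free_group X)" by (rule homI) auto
  have 1: "?g (?h w) = w" if "w \<in> ?C" for w
    using F.free_hom_eqI[OF hom_compose[OF hom(2,1)] id _ that] h gh
    by (force simp: F.free_lift_gen Pi_iff)
  have 2: "?h (?g w) = w" if "w \<in> ?C" for w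
    using F.free_hom_eqI[OF hom_compose[OF hom] id _ that] g hg
    by (force simp: F.free_lift_gen Pi_iff)
  have cl: "?g w \<in> ?C" "?h w \<in> ?C" if "w \<in> ?C" for w
    using hom that by (auto simp: hom_def)
  have "bij_betw ?g ?C ?C"
    by (rule bij_betw_byWitness[where f' = ?h]) (use 1 2 cl in auto)
  then have "restrict ?g ?C \<in> Bij ?C" by (simp add: Bij_def)
  moreover have "restrict ?g ?C \<in> hom (free_group X) (free_group X)"
    using hom(1) by (auto simp: hom_def)
  ultimately show ?thesis by (simp add: AutoGroup_def auto_def)
qed

lemma
  fixes X :: "'a set"
  assumes ij: "i \<in> X" "j \<in> X" "i \<noteq> j"
  shows ex_left_transvection: "\<exists>f\<in>carrier (AutoGroup (free_group X)).
      f (gen i) = gen j \<otimes>\<^bsub>free_group X\<^esub> gen i \<and> (\<forall>k\<in>X - {i}. f (gen k) = gen k)"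
    and ex_right_transvection: "\<exists>f\<in>carrier (AutoGroup (free_group X)).
      f (gen i) = gen i \<otimes>\<^bsub>free_group X\<^esub> gen j \<and> (\<forall>k\<in>X - {i}. f (gen k) = gen k)"
proof -
  let ?G = "free_group X"
  interpret G: group "?G" by (rule group_free_group)
  note gc = gen_carrier[of _ X]
  let ?L = "\<lambda>g. free_lift ?G g"
  have I: "gen i \<in> carrier ?G" and J: "gen j \<in> carrier ?G" using ij gc by auto
  have lift_gen: "?L g (gen x) = g x" if "g x \<in> carrier ?G"
    for g :: "'a \<Rightarrow> 'a letter list" and x
    using that by (rule G.free_lift_gen)
  have lift_mult: "?L g (u \<otimes>\<^bsub>?G\<^esub> v) = ?L g u \<otimes>\<^bsub>?G\<^esub> ?L g v"
    if "g \<in> X \<rightarrow> carrier ?G" "u \<in> carrier ?G" "v \<in> carrier ?G"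
    for g :: "'a \<Rightarrow> 'a letter list" and u v
    using G.free_lift_hom[OF that(1)] that by (auto simp: hom_def)
  have lift_inv: "?L g (inv\<^bsub>?G\<^esub> u) = inv\<^bsub>?G\<^esub> ?L g u"
    if "g \<in> X \<rightarrow> carrier ?G" "u \<in> carrier ?G"
    for g :: "'a \<Rightarrow> 'a letter list" and u
    using group_hom.hom_inv[of "?G" "?G" "?L g" u]
      G.free_lift_hom[OF that(1)] that(2)
    by (simp add: group_hom_def group_hom_axioms_def G.group_axioms)
  have aut: "restrict (?L (gen(i := p))) (carrier ?G) \<in> carrier (AutoGroup ?G)"
    if "p \<in> carrier ?G" "q \<in> carrier ?G"
      "?L (gen(i := p)) q = gen i" "?L (gen(i := q)) p = gen i" for p q
    by (rule free_lift_autoI[where h = "gen(i := q)"]) (use that gc in \<open>auto simp: lift_gen\<close>)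
  have fn: "gen(i := p) \<in> X \<rightarrow> carrier ?G" if "p \<in> carrier ?G" for p
    using that gc by auto
  let ?f = "restrict (?L (gen(i := gen j \<otimes>\<^bsub>?G\<^esub> gen i))) (carrier ?G)"
  show "\<exists>f\<in>carrier (AutoGroup ?G).
      f (gen i) = gen j \<otimes>\<^bsub>?G\<^esub> gen i \<and> (\<forall>k\<in>X - {i}. f (gen k) = gen k)"
  proof (intro bexI[of _ ?f] conjI ballI)
    show "?f (gen i) = gen j \<otimes>\<^bsub>?G\<^esub> gen i" using I J by (simp add: lift_gen)
    show "?f (gen k) = gen k" if "k \<in> X - {i}" for k
      using that gc by (auto simp: lift_gen)
    show "?f \<in> carrier (AutoGroup ?G)"
      by (rule aut[of _ "inv\<^bsub>?G\<^esub> gen j \<otimes>\<^bsub>?G\<^esub> gen i"])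
        (use I J ij in \<open>simp_all add: fn lift_mult lift_inv lift_gen G.m_assoc[symmetric]\<close>)
  qed
  let ?f = "restrict (?L (gen(i := gen i \<otimes>\<^bsub>?G\<^esub> gen j))) (carrier ?G)"
  show "\<exists>f\<in>carrier (AutoGroup ?G).
      f (gen i) = gen i \<otimes>\<^bsub>?G\<^esub> gen j \<and> (\<forall>k\<in>X - {i}. f (gen k) = gen k)"
  proof (intro bexI[of _ ?f] conjI ballI)
    show "?f (gen i) = gen i \<otimes>\<^bsub>?G\<^esub> gen j" using I J by (simp add: lift_gen)
    show "?f (gen k) = gen k" if "k \<in> X - {i}" for k
      using that gc by (auto simp: lift_gen)
    show "?f \<in> carrier (AutoGroup ?G)"
      by (rule aut[of _ "gen i \<otimes>\<^bsub>?G\<^esub> inv\<^bsub>?G\<^esub> gen j"])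
        (use I J ij in \<open>simp_all add: fn lift_mult lift_inv lift_gen G.m_assoc\<close>)
  qed
qed

lemma
  assumes "i \<in> {1..n}" "j \<in> {1..n}" "i \<noteq> j"
  shows ex_left_nielsen: "\<exists>f. is_left_nielsen n i j f"
    and ex_right_nielsen: "\<exists>f. is_right_nielsen n i j f"
  unfolding is_left_nielsen_def is_right_nielsen_def
  using ex_left_transvection[OF assms] ex_right_transvection[OF assms] by blast+

section \<open>The special linear group\<close>

definition SL :: "nat \<Rightarrow> real mat monoid" where
  "SL d = \<lparr>carrier = {A \<in> carrier_mat d d. det A = 1}, monoid.mult = (*), one = 1\<^sub>m d\<rparr>"

end

theory Submission
  imports Defs
begin

text \<open>
  The argument is a factorisation of a transvection inside its own centralizer. Let
  \<open>\<lambda>: x \<mapsto> yx\<close>. Every automorphism commuting with \<open>\<lambda>\<close> is sent by a linear representation to a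
  matrix commuting with the image \<open>M\<close> of \<open>\<lambda>\<close>, hence preserves each eigenspace
  \<open>E\<^sub>\<mu> = ker (M - \<mu>)\<close>. Taking the determinant of the restriction to \<open>E\<^sub>\<mu>\<close> gives a homomorphism from
  the centralizer of \<open>\<lambda>\<close> to the multiplicative group of the field, with value \<open>\<mu> ^ dim E\<^sub>\<mu>\<close> at
  \<open>\<lambda>\<close> (\<open>eigenspace_determinant\<close>). But \<open>\<lambda>\<close> is trivial in the abelianisation of its centralizer
  as soon as the basis has two elements besides \<open>x\<close> and \<open>y\<close> (\<open>transvection_relations\<close>), so this
  value is 1. Hence every eigenvalue of \<open>M\<close> is a root of unity, and in particular has modulus 1.
  A right transvection \<open>x \<mapsto> xy\<close> becomes a left one after inverting \<open>x\<close> and \<open>y\<close>, so its image has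
  the same eigenvalues as that of a left transvection.

  The relations come from the following picture. With \<open>b = x\<^sup>-\<^sup>1yx\<close>, the free group is an HNN
  extension with stable letter \<open>x\<close> of the free group \<open>H\<close> on \<open>b\<close> and the other basis elements, and
  \<open>\<lambda>\<close> is the twist along the edge group: it fixes \<open>H\<close> and multiplies \<open>x\<close> by \<open>y\<close>. Automorphisms
  of \<open>H\<close> that fix \<open>y\<close> and send \<open>b\<close> to a conjugate extend to the centralizer of \<open>\<lambda>\<close>. Thus
  \<open>b\<close> may be used to move other basis elements (\<open>z \<mapsto> zb\<close>, \<open>z \<mapsto> bz\<close>), and these moves are
  commutators in the centralizer in the same way as elementary matrices are. On the other hand
  \<open>b\<close> is itself conjugated by \<open>x \<mapsto> xz\<close>, and the choice of the conjugating element, unique only up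
  to powers of \<open>b\<close>, is what produces \<open>\<lambda>\<close>.
\<close>

section \<open>Automorphisms of a free group\<close>

lemma AutoGroup_mult_apply:
  assumes "f \<in> carrier (AutoGroup G)" "g \<in> carrier (AutoGroup G)" "w \<in> carrier G"
  shows "(f \<otimes>\<^bsub>AutoGroup G\<^esub> g) w = f (g w)"
  using assms by (auto simp: AutoGroup_def BijGroup_def auto_def compose_def)

lemma AutoGroup_hom: "f \<in> carrier (AutoGroup G) \<Longrightarrow> f \<in> hom G G"
  by (simp add: AutoGroup_def auto_def)

lemma free_AutoGroup_eqI:
  assumes f: "f \<in> carrier (AutoGroup (free_group X))" and g: "g \<in> carrier (AutoGroup (free_group X))"
    and eq: "\<And>x. x \<in> X \<Longrightarrow> f (gen x) = g (gen x)"
  shows "f = g"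
proof (rule extensionalityI)
  show "f \<in> extensional (carrier (free_group X))" "g \<in> extensional (carrier (free_group X))"
    using f g by (auto simp: AutoGroup_def auto_def Bij_def)
  show "f w = g w" if "w \<in> carrier (free_group X)" for w
    using group.free_hom_eqI[OF group_free_group AutoGroup_hom[OF f] AutoGroup_hom[OF g] eq that] .
qed

lemma free_group_mono: "Y \<subseteq> X \<Longrightarrow> carrier (free_group Y) \<subseteq> carrier (free_group X)"
  by (auto simp: free_group_def)

lemma free_group_mult_cong: "monoid.mult (free_group Y) = monoid.mult (free_group X)"
  by (simp add: free_group_def)

text \<open>The inverse is \<open>x \<mapsto> a\<^sup>-\<^sup>1 x c\<^sup>-\<^sup>1\<close>: both maps fix \<open>a\<close> and \<open>c\<close>, since these are words in the
  remaining generators.\<close>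

lemma ex_two_sided_transvection:
  assumes x: "x \<in> X" and a: "a \<in> carrier (free_group (X - {x}))"
    and c: "c \<in> carrier (free_group (X - {x}))"
  obtains f where "f \<in> carrier (AutoGroup (free_group X))"
    "f (gen x) = a \<otimes>\<^bsub>free_group X\<^esub> (gen x \<otimes>\<^bsub>free_group X\<^esub> c)"
    "\<And>w. w \<in> carrier (free_group (X - {x})) \<Longrightarrow> f w = w"
proof -
  let ?F = "free_group X" and ?Y = "free_group (X - {x})"
  interpret F: group ?F by (rule group_free_group)
  have sub: "w \<in> carrier ?F" if "w \<in> carrier ?Y" for w
    using free_group_mono[of "X - {x}" X] that by auto
  note gc = gen_carrier[of _ X]
  define g where "g p q = gen(x := p \<otimes>\<^bsub>?F\<^esub> (gen x \<otimes>\<^bsub>?F\<^esub> q))" for p q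
  have g: "g p q \<in> X \<rightarrow> carrier ?F" if "p \<in> carrier ?F" "q \<in> carrier ?F" for p q
    using that gc x by (auto simp: g_def)
  have fix_words: "free_lift ?F (g p q) w = w"
    if "p \<in> carrier ?F" "q \<in> carrier ?F" "w \<in> carrier ?Y" for p q w
  proof (rule F.free_hom_eqI[of _ "X - {x}" "\<lambda>w. w", OF _ _ _ that(3)])
    show "free_lift ?F (g p q) \<in> hom ?Y ?F"
      using F.free_lift_hom[of "g p q" "X - {x}"] g[OF that(1,2)] by auto
    show "(\<lambda>w. w) \<in> hom ?Y ?F"
      using sub by (intro homI) (auto simp: free_group_mult_cong[of "X - {x}" X])
    fix y assume "y \<in> X - {x}"
    then show "free_lift ?F (g p q) (gen y) = gen y"
      using gc F.free_lift_gen[of "g p q" y] by (auto simp: g_def)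
  qed
  have move: "free_lift ?F (g p q) (g r s x) = gen x"
    if "p \<in> carrier ?F" "q \<in> carrier ?F" "r \<in> carrier ?Y" "s \<in> carrier ?Y"
      "r \<otimes>\<^bsub>?F\<^esub> p = \<one>\<^bsub>?F\<^esub>" "q \<otimes>\<^bsub>?F\<^esub> s = \<one>\<^bsub>?F\<^esub>" for p q r s
  proof -
    have rs: "r \<in> carrier ?F" "s \<in> carrier ?F" "gen x \<in> carrier ?F"
      using sub that gc[OF x] by auto
    have "free_lift ?F (g p q) (g r s x)
        = r \<otimes>\<^bsub>?F\<^esub> ((p \<otimes>\<^bsub>?F\<^esub> (gen x \<otimes>\<^bsub>?F\<^esub> q)) \<otimes>\<^bsub>?F\<^esub> s)"
      using hom_mult[OF F.free_lift_hom[OF g[OF that(1,2)]]] that rs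
        F.free_lift_gen[of "g p q" x] fix_words[OF that(1,2)]
      by (simp add: g_def)
    also have "\<dots> = (r \<otimes>\<^bsub>?F\<^esub> p) \<otimes>\<^bsub>?F\<^esub> (gen x \<otimes>\<^bsub>?F\<^esub> (q \<otimes>\<^bsub>?F\<^esub> s))"
      using that(1,2) rs by (simp add: F.m_assoc)
    finally show ?thesis using that rs by simp
  qed
  interpret Y: group ?Y by (rule group_free_group)
  define a' where "a' = inv\<^bsub>?Y\<^esub> a"
  define c' where "c' = inv\<^bsub>?Y\<^esub> c"
  have inv: "a' \<in> carrier ?Y" "c' \<in> carrier ?Y"
    "a' \<otimes>\<^bsub>?F\<^esub> a = \<one>\<^bsub>?F\<^esub>" "a \<otimes>\<^bsub>?F\<^esub> a' = \<one>\<^bsub>?F\<^esub>"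
    "c' \<otimes>\<^bsub>?F\<^esub> c = \<one>\<^bsub>?F\<^esub>" "c \<otimes>\<^bsub>?F\<^esub> c' = \<one>\<^bsub>?F\<^esub>"
    using Y.inv_closed[OF a] Y.inv_closed[OF c]
      Y.l_inv[OF a] Y.r_inv[OF a] Y.l_inv[OF c] Y.r_inv[OF c]
    unfolding a'_def[symmetric] c'_def[symmetric] by (simp_all add: free_group_def)
  let ?f = "restrict (free_lift ?F (g a c)) (carrier ?F)"
  show thesis
  proof (rule that[of ?f])
    note ac = sub[OF a] sub[OF c] and ac' = sub[OF inv(1)] sub[OF inv(2)]
    have other: "free_lift ?F (g p q) (g r s y) = gen y"
      if "p \<in> carrier ?F" "q \<in> carrier ?F" "y \<in> X" "y \<noteq> x" for p q r s y
      using F.free_lift_gen[of "g p q" y] that gc by (simp add: g_def)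
    show "?f \<in> carrier (AutoGroup ?F)"
    proof (rule free_lift_autoI[OF g[OF ac] g[OF ac']])
      fix y assume "y \<in> X"
      then show "free_lift ?F (g a c) (g a' c' y) = gen y"
        using move[OF ac inv(1,2)] inv other[OF ac] by (cases "y = x") auto
      show "free_lift ?F (g a' c') (g a c y) = gen y"
        using move[OF ac' a c] inv other[OF ac'] \<open>y \<in> X\<close> by (cases "y = x") auto
    qed
    show "?f (gen x) = a \<otimes>\<^bsub>?F\<^esub> (gen x \<otimes>\<^bsub>?F\<^esub> c)"
      using gc[OF x] F.free_lift_gen[of "g a c" x] ac by (simp add: g_def)
    show "?f w = w" if "w \<in> carrier ?Y" for w
      using fix_words[OF ac that] sub[OF that] by simp
  qed
qed

text \<open>Put \<open>b = x\<^sup>-\<^sup>1yx\<close>, which is fixed by \<open>l: x \<mapsto> yx\<close>, and take, each fixing the remaining generators,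
  \<open>A: x \<mapsto> xz\<close>, \<open>P: z \<mapsto> zb\<close>, \<open>L: z \<mapsto> bz\<close>, \<open>p: z \<mapsto> uz\<close>, \<open>q: u \<mapsto> bu\<close>, \<open>r: z \<mapsto> zu\<close>,
  \<open>s: u \<mapsto> ub\<close>. The last two relations express \<open>L\<close> and \<open>P\<close> as commutators. The first one holds
  because \<open>A\<close> maps \<open>b\<close> to \<open>z\<^sup>-\<^sup>1bz\<close> and so turns \<open>P\<close> into \<open>z \<mapsto> bz\<close>, while on \<open>x\<close> the two
  sides are \<open>l(xz) = yxz\<close> and \<open>L(xz) = xbz = yxz\<close>.\<close>

lemma transvection_relations:
  fixes X :: "'a set" and x y z u :: 'a
  defines "\<A> \<equiv> AutoGroup (free_group X)"
  assumes X: "x \<in> X" "y \<in> X" "z \<in> X" "u \<in> X"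
    and ne: "distinct [x, y, z, u]"
    and l: "l \<in> carrier \<A>" "l (gen x) = gen y \<otimes>\<^bsub>free_group X\<^esub> gen x"
      "\<And>k. k \<in> X - {x} \<Longrightarrow> l (gen k) = gen k"
  obtains A P L p q r s
  where "{A, P, L, p, q, r, s} \<subseteq> {f \<in> carrier \<A>. f \<otimes>\<^bsub>\<A>\<^esub> l = l \<otimes>\<^bsub>\<A>\<^esub> f}"
    "l \<otimes>\<^bsub>\<A>\<^esub> (A \<otimes>\<^bsub>\<A>\<^esub> P) = L \<otimes>\<^bsub>\<A>\<^esub> A"
    "q \<otimes>\<^bsub>\<A>\<^esub> p = p \<otimes>\<^bsub>\<A>\<^esub> (L \<otimes>\<^bsub>\<A>\<^esub> q)"
    "s \<otimes>\<^bsub>\<A>\<^esub> r = r \<otimes>\<^bsub>\<A>\<^esub> (P \<otimes>\<^bsub>\<A>\<^esub> s)"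
proof -
  let ?F = "free_group X"
  interpret F: group ?F by (rule group_free_group)
  interpret A: group \<A> unfolding \<A>_def by (rule F.AutoGroup)
  have dist: "x \<noteq> y" "x \<noteq> z" "x \<noteq> u" "y \<noteq> z" "y \<noteq> u" "z \<noteq> u"
    "y \<noteq> x" "z \<noteq> x" "u \<noteq> x" "z \<noteq> y" "u \<noteq> y" "u \<noteq> z"
    using ne by auto
  have gc: "gen k \<in> carrier ?F" if "k \<in> X" for k using that by (rule gen_carrier)
  note gcX = gc[OF X(1)] gc[OF X(2)] gc[OF X(3)] gc[OF X(4)]
  have one: "\<one>\<^bsub>?F\<^esub> \<in> carrier (free_group Y)" for Y :: "'a set" by (simp add: free_group_def)
  define b where "b = [(x, False), (y, True), (x, True)]"
  have bY: "b \<in> carrier (free_group Y)" if "x \<in> Y" "y \<in> Y" for Y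
    using that dist by (auto simp: b_def free_group_def inv_letter_def)
  note b = bY[OF X(1,2)]
  have xb: "gen x \<otimes>\<^bsub>?F\<^esub> b = gen y \<otimes>\<^bsub>?F\<^esub> gen x"
    using dist by (simp add: b_def gen_def free_group_def inv_letter_def)
  obtain A where A: "A \<in> carrier \<A>" "A (gen x) = \<one>\<^bsub>?F\<^esub> \<otimes>\<^bsub>?F\<^esub> (gen x \<otimes>\<^bsub>?F\<^esub> gen z)"
    "\<And>w. w \<in> carrier (free_group (X - {x})) \<Longrightarrow> A w = w"
    unfolding \<A>_def
    by (rule ex_two_sided_transvection[OF X(1) one, where c = "gen z"])
      (use X dist in \<open>auto intro: gen_carrier\<close>)
  obtain P where P: "P \<in> carrier \<A>" "P (gen z) = \<one>\<^bsub>?F\<^esub> \<otimes>\<^bsub>?F\<^esub> (gen z \<otimes>\<^bsub>?F\<^esub> b)"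
    "\<And>w. w \<in> carrier (free_group (X - {z})) \<Longrightarrow> P w = w"
    unfolding \<A>_def
    by (rule ex_two_sided_transvection[OF X(3) one, where c = b])
      (use X dist in \<open>auto intro: bY\<close>)
  obtain L where L: "L \<in> carrier \<A>" "L (gen z) = b \<otimes>\<^bsub>?F\<^esub> (gen z \<otimes>\<^bsub>?F\<^esub> \<one>\<^bsub>?F\<^esub>)"
    "\<And>w. w \<in> carrier (free_group (X - {z})) \<Longrightarrow> L w = w"
    unfolding \<A>_def
    by (rule ex_two_sided_transvection[OF X(3) _ one, where a = b])
      (use X dist in \<open>auto intro: bY\<close>)
  obtain p where p: "p \<in> carrier \<A>" "p (gen z) = gen u \<otimes>\<^bsub>?F\<^esub> (gen z \<otimes>\<^bsub>?F\<^esub> \<one>\<^bsub>?F\<^esub>)"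
    "\<And>w. w \<in> carrier (free_group (X - {z})) \<Longrightarrow> p w = w"
    unfolding \<A>_def
    by (rule ex_two_sided_transvection[OF X(3) _ one, where a = "gen u"])
      (use X dist in \<open>auto intro: gen_carrier\<close>)
  obtain q where q: "q \<in> carrier \<A>" "q (gen u) = b \<otimes>\<^bsub>?F\<^esub> (gen u \<otimes>\<^bsub>?F\<^esub> \<one>\<^bsub>?F\<^esub>)"
    "\<And>w. w \<in> carrier (free_group (X - {u})) \<Longrightarrow> q w = w"
    unfolding \<A>_def
    by (rule ex_two_sided_transvection[OF X(4) _ one, where a = b])
      (use X dist in \<open>auto intro: bY\<close>)
  obtain r where r: "r \<in> carrier \<A>" "r (gen z) = \<one>\<^bsub>?F\<^esub> \<otimes>\<^bsub>?F\<^esub> (gen z \<otimes>\<^bsub>?F\<^esub> gen u)"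
    "\<And>w. w \<in> carrier (free_group (X - {z})) \<Longrightarrow> r w = w"
    unfolding \<A>_def
    by (rule ex_two_sided_transvection[OF X(3) one, where c = "gen u"])
      (use X dist in \<open>auto intro: gen_carrier\<close>)
  obtain s where s: "s \<in> carrier \<A>" "s (gen u) = \<one>\<^bsub>?F\<^esub> \<otimes>\<^bsub>?F\<^esub> (gen u \<otimes>\<^bsub>?F\<^esub> b)"
    "\<And>w. w \<in> carrier (free_group (X - {u})) \<Longrightarrow> s w = w"
    unfolding \<A>_def
    by (rule ex_two_sided_transvection[OF X(4) one, where c = b])
      (use X dist in \<open>auto intro: bY\<close>)
  note carr = l(1) A(1) P(1) L(1) p(1) q(1) r(1) s(1)
  have mult: "f (v \<otimes>\<^bsub>?F\<^esub> w) = f v \<otimes>\<^bsub>?F\<^esub> f w"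
    if "f \<in> carrier \<A>" "v \<in> carrier ?F" "w \<in> carrier ?F" for f v w
    using that(2,3) by (rule hom_mult[OF AutoGroup_hom[OF that(1)[unfolded \<A>_def]]])
  have app: "(f \<otimes>\<^bsub>\<A>\<^esub> g) w = f (g w)" if "f \<in> carrier \<A>" "g \<in> carrier \<A>" "w \<in> carrier ?F" for f g w
    using that unfolding \<A>_def by (rule AutoGroup_mult_apply)
  have cl: "f w \<in> carrier ?F" if "f \<in> carrier \<A>" "w \<in> carrier ?F" for f w
    using that(2) by (rule hom_in_carrier[OF AutoGroup_hom[OF that(1)[unfolded \<A>_def]]])
  have on_b: "P b = b" "L b = b" "p b = b" "q b = b" "r b = b" "s b = b"
    using P(3) L(3) p(3) q(3) r(3) s(3) bY[of "X - {z}"] bY[of "X - {u}"] X dist by auto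
  \<comment> \<open>the values of \<open>l\<close> and \<open>A\<close> at \<open>b\<close> follow by applying them to \<open>xb = yx\<close> and cancelling\<close>
  have "gen y \<otimes>\<^bsub>?F\<^esub> (gen x \<otimes>\<^bsub>?F\<^esub> l b) = l (gen x \<otimes>\<^bsub>?F\<^esub> b)"
    using l mult[OF l(1) gcX(1) b] cl[OF l(1) b] gcX by (simp add: F.m_assoc)
  also have "\<dots> = gen y \<otimes>\<^bsub>?F\<^esub> (gen x \<otimes>\<^bsub>?F\<^esub> b)"
    unfolding xb using l mult[OF l(1) gcX(2,1)] X dist by simp
  finally have lb: "l b = b" using gcX b cl[OF l(1) b] by simp
  have "gen x \<otimes>\<^bsub>?F\<^esub> (gen z \<otimes>\<^bsub>?F\<^esub> A b) = A (gen x \<otimes>\<^bsub>?F\<^esub> b)"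
    using A mult[OF A(1) gcX(1) b] cl[OF A(1) b] gcX by (simp add: F.m_assoc)
  also have "\<dots> = gen y \<otimes>\<^bsub>?F\<^esub> (gen x \<otimes>\<^bsub>?F\<^esub> gen z)"
    unfolding xb using A(2) A(3)[of "gen y"] mult[OF A(1) gcX(2,1)] gcX X dist
    by (simp add: gen_carrier)
  also have "\<dots> = gen x \<otimes>\<^bsub>?F\<^esub> (b \<otimes>\<^bsub>?F\<^esub> gen z)"
    using xb gcX b by (simp add: F.m_assoc[symmetric])
  finally have zAb: "gen z \<otimes>\<^bsub>?F\<^esub> A b = b \<otimes>\<^bsub>?F\<^esub> gen z"
    using gcX b cl[OF A(1) b] by simp
  have on_gen: "A (gen k) = (if k = x then gen x \<otimes>\<^bsub>?F\<^esub> gen z else gen k)"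
    "P (gen k) = (if k = z then gen z \<otimes>\<^bsub>?F\<^esub> b else gen k)"
    "L (gen k) = (if k = z then b \<otimes>\<^bsub>?F\<^esub> gen z else gen k)"
    "p (gen k) = (if k = z then gen u \<otimes>\<^bsub>?F\<^esub> gen z else gen k)"
    "q (gen k) = (if k = u then b \<otimes>\<^bsub>?F\<^esub> gen u else gen k)"
    "r (gen k) = (if k = z then gen z \<otimes>\<^bsub>?F\<^esub> gen u else gen k)"
    "s (gen k) = (if k = u then gen u \<otimes>\<^bsub>?F\<^esub> b else gen k)"
    "l (gen k) = (if k = x then gen y \<otimes>\<^bsub>?F\<^esub> gen x else gen k)" if "k \<in> X" for k
    using A(2) P(2) L(2) p(2) q(2) r(2) s(2) l(2,3) gcX b that gen_carrier[of k]
    by (auto intro!: A(3) P(3) L(3) p(3) q(3) r(3) s(3))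
  have eqI: "f = g" if "f \<in> carrier \<A>" "g \<in> carrier \<A>" "\<And>k. k \<in> X \<Longrightarrow> f (gen k) = g (gen k)" for f g
    using that unfolding \<A>_def by (rule free_AutoGroup_eqI)
  note compute = app carr mult cl on_gen on_b lb zAb gc b X dist F.m_assoc
  show thesis
  proof (rule that)
    have "f \<otimes>\<^bsub>\<A>\<^esub> l = l \<otimes>\<^bsub>\<A>\<^esub> f" if "f \<in> {A, P, L, p, q, r, s}" for f
      using that by (intro eqI) (auto simp: compute)
    then show "{A, P, L, p, q, r, s} \<subseteq> {f \<in> carrier \<A>. f \<otimes>\<^bsub>\<A>\<^esub> l = l \<otimes>\<^bsub>\<A>\<^esub> f}"
      using carr by auto
    show "l \<otimes>\<^bsub>\<A>\<^esub> (A \<otimes>\<^bsub>\<A>\<^esub> P) = L \<otimes>\<^bsub>\<A>\<^esub> A"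
    proof (rule eqI)
      have xbz: "gen x \<otimes>\<^bsub>?F\<^esub> (b \<otimes>\<^bsub>?F\<^esub> gen z) = gen y \<otimes>\<^bsub>?F\<^esub> (gen x \<otimes>\<^bsub>?F\<^esub> gen z)"
        using xb gcX b by (simp add: F.m_assoc[symmetric])
      show "(l \<otimes>\<^bsub>\<A>\<^esub> (A \<otimes>\<^bsub>\<A>\<^esub> P)) (gen k) = (L \<otimes>\<^bsub>\<A>\<^esub> A) (gen k)" if "k \<in> X" for k
        using that by (auto simp: compute xbz)
    qed (use carr in auto)
    show "q \<otimes>\<^bsub>\<A>\<^esub> p = p \<otimes>\<^bsub>\<A>\<^esub> (L \<otimes>\<^bsub>\<A>\<^esub> q)"
      by (rule eqI) (auto simp: compute)
    show "s \<otimes>\<^bsub>\<A>\<^esub> r = r \<otimes>\<^bsub>\<A>\<^esub> (P \<otimes>\<^bsub>\<A>\<^esub> s)"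
      by (rule eqI) (auto simp: compute)
  qed
qed
section \<open>Characters of the centralizer of a transvection\<close>

text \<open>The relations give \<open>\<chi> L = \<chi> P = 1\<close> and then \<open>\<chi> l = 1\<close>, once all values of \<open>\<chi>\<close> can be cancelled;
  they can because centralizers are closed under inverses.\<close>

lemma transvection_character_trivial:
  fixes X :: "'a set" and \<chi> :: "_ \<Rightarrow> 'k::field"
  defines "\<A> \<equiv> AutoGroup (free_group X)"
  defines "Z \<equiv> \<lambda>l. {f \<in> carrier \<A>. f \<otimes>\<^bsub>\<A>\<^esub> l = l \<otimes>\<^bsub>\<A>\<^esub> f}"
  assumes "{x, y, z, u} \<subseteq> X" and "distinct [x, y, z, u]"
    and l: "l \<in> carrier \<A>" "l (gen x) = gen y \<otimes>\<^bsub>free_group X\<^esub> gen x"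
      "\<And>k. k \<in> X - {x} \<Longrightarrow> l (gen k) = gen k"
    and mult: "\<And>f g. f \<in> Z l \<Longrightarrow> g \<in> Z l \<Longrightarrow> \<chi> (f \<otimes>\<^bsub>\<A>\<^esub> g) = \<chi> f * \<chi> g"
    and one: "\<chi> \<one>\<^bsub>\<A>\<^esub> = 1"
  shows "\<chi> l = 1"
proof -
  interpret A: group \<A> unfolding \<A>_def by (rule group.AutoGroup[OF group_free_group])
  have lZ: "l \<in> Z l" using l by (simp add: Z_def)
  have prodZ: "f \<otimes>\<^bsub>\<A>\<^esub> g \<in> Z l" if "f \<in> Z l" "g \<in> Z l" for f g
  proof -
    have "f \<otimes>\<^bsub>\<A>\<^esub> g \<otimes>\<^bsub>\<A>\<^esub> l = f \<otimes>\<^bsub>\<A>\<^esub> (l \<otimes>\<^bsub>\<A>\<^esub> g)"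
      using that l(1) by (simp add: Z_def A.m_assoc)
    also have "\<dots> = l \<otimes>\<^bsub>\<A>\<^esub> (f \<otimes>\<^bsub>\<A>\<^esub> g)"
      using that l(1) by (simp add: Z_def A.m_assoc[symmetric])
    finally show ?thesis using that by (simp add: Z_def)
  qed
  have nz: "\<chi> f \<noteq> 0" if f: "f \<in> Z l" for f
  proof -
    have fc: "f \<in> carrier \<A>" "f \<otimes>\<^bsub>\<A>\<^esub> l = l \<otimes>\<^bsub>\<A>\<^esub> f" using f by (auto simp: Z_def)
    have "inv\<^bsub>\<A>\<^esub> f \<otimes>\<^bsub>\<A>\<^esub> l = l \<otimes>\<^bsub>\<A>\<^esub> inv\<^bsub>\<A>\<^esub> f"
      using fc l(1) by (metis A.inv_closed A.inv_solve_left' A.inv_solve_right' A.m_assoc A.m_closed)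
    then have "inv\<^bsub>\<A>\<^esub> f \<in> Z l" using fc by (simp add: Z_def)
    then have "\<chi> f * \<chi> (inv\<^bsub>\<A>\<^esub> f) = 1"
      using mult[OF f] one fc by (metis A.r_inv)
    then show ?thesis by auto
  qed
  obtain A P L p q r s
    where Z: "{A, P, L, p, q, r, s} \<subseteq> Z l"
      and eq: "l \<otimes>\<^bsub>\<A>\<^esub> (A \<otimes>\<^bsub>\<A>\<^esub> P) = L \<otimes>\<^bsub>\<A>\<^esub> A"
        "q \<otimes>\<^bsub>\<A>\<^esub> p = p \<otimes>\<^bsub>\<A>\<^esub> (L \<otimes>\<^bsub>\<A>\<^esub> q)"
        "s \<otimes>\<^bsub>\<A>\<^esub> r = r \<otimes>\<^bsub>\<A>\<^esub> (P \<otimes>\<^bsub>\<A>\<^esub> s)"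
    unfolding Z_def \<A>_def
    by (rule transvection_relations[of x X y z u l]) (use assms in auto)
  have "\<chi> q * \<chi> p = \<chi> p * (\<chi> L * \<chi> q)"
    using Z mult prodZ arg_cong[OF eq(2), of \<chi>] by simp
  then have L: "\<chi> L = 1" using nz Z by (simp add: mult.commute)
  have "\<chi> s * \<chi> r = \<chi> r * (\<chi> P * \<chi> s)"
    using Z mult prodZ arg_cong[OF eq(3), of \<chi>] by simp
  then have P: "\<chi> P = 1" using nz Z by (simp add: mult.commute)
  have "\<chi> l * (\<chi> A * \<chi> P) = \<chi> L * \<chi> A"
    using Z lZ mult prodZ arg_cong[OF eq(1), of \<chi>] by simp
  then show ?thesis using L P nz[of A] Z by simp
qed

text \<open>The conjugating automorphism inverts \<open>x\<close> and \<open>y\<close>: it maps \<open>xy\<close> to \<open>x\<^sup>-\<^sup>1y\<^sup>-\<^sup>1 = (yx)\<^sup>-\<^sup>1\<close>.\<close>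

lemma right_transvection_conjugate_left:
  fixes X :: "'a set" and x y :: 'a
  defines "\<A> \<equiv> AutoGroup (free_group X)"
  assumes X: "x \<in> X" "y \<in> X" "x \<noteq> y"
    and l: "l \<in> carrier \<A>" "l (gen x) = gen y \<otimes>\<^bsub>free_group X\<^esub> gen x"
      "\<And>k. k \<in> X - {x} \<Longrightarrow> l (gen k) = gen k"
    and r: "r \<in> carrier \<A>" "r (gen x) = gen x \<otimes>\<^bsub>free_group X\<^esub> gen y"
      "\<And>k. k \<in> X - {x} \<Longrightarrow> r (gen k) = gen k"
  obtains \<kappa> where "\<kappa> \<in> carrier \<A>" "\<kappa> \<otimes>\<^bsub>\<A>\<^esub> r = l \<otimes>\<^bsub>\<A>\<^esub> \<kappa>"
proof -
  let ?F = "free_group X"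
  interpret F: group ?F by (rule group_free_group)
  interpret A: group \<A> unfolding \<A>_def by (rule F.AutoGroup)
  have gc: "gen k \<in> carrier ?F" if "k \<in> X" for k using that by (rule gen_carrier)
  define g where "g k = (if k \<in> {x, y} then inv\<^bsub>?F\<^esub> gen k else gen k)" for k
  have g: "g \<in> X \<rightarrow> carrier ?F" using gc X by (auto simp: g_def)
  have lift: "free_lift ?F g (gen k) = g k" if "k \<in> X" for k
    using F.free_lift_gen[of g k] g that by auto
  interpret lift: group_hom ?F ?F "free_lift ?F g"
    using F.free_lift_hom[OF g] by unfold_locales
  have "free_lift ?F g (g k) = gen k" if "k \<in> X" for k
    using that lift[OF that] gc[OF that] by (auto simp: g_def)
  then have \<kappa>: "restrict (free_lift ?F g) (carrier ?F) \<in> carrier \<A>" (is "?\<kappa> \<in> _")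
    unfolding \<A>_def by (intro free_lift_autoI[OF g g])
  have \<kappa>_gen: "?\<kappa> (gen k) = g k" if "k \<in> X" for k using lift[OF that] gc[OF that] by simp
  have mult: "f (v \<otimes>\<^bsub>?F\<^esub> w) = f v \<otimes>\<^bsub>?F\<^esub> f w"
    if "f \<in> carrier \<A>" "v \<in> carrier ?F" "w \<in> carrier ?F" for f v w
    using that(2,3) by (rule hom_mult[OF AutoGroup_hom[OF that(1)[unfolded \<A>_def]]])
  have linv: "l (inv\<^bsub>?F\<^esub> v) = inv\<^bsub>?F\<^esub> l v" if "v \<in> carrier ?F" for v
    using group_hom.hom_inv[of ?F ?F l v] AutoGroup_hom[of l ?F] l(1) that
    by (simp add: group_hom_def group_hom_axioms_def F.group_axioms \<A>_def)
  have app: "(f \<otimes>\<^bsub>\<A>\<^esub> h) w = f (h w)" if "f \<in> carrier \<A>" "h \<in> carrier \<A>" "w \<in> carrier ?F" for f h w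
    using that unfolding \<A>_def by (rule AutoGroup_mult_apply)
  have "?\<kappa> \<otimes>\<^bsub>\<A>\<^esub> r = l \<otimes>\<^bsub>\<A>\<^esub> ?\<kappa>"
  proof (rule free_AutoGroup_eqI[of _ X, folded \<A>_def])
    fix k assume k: "k \<in> X"
    have "?\<kappa> (r (gen k)) = l (?\<kappa> (gen k))"
    proof (cases "k = x")
      case True
      have "?\<kappa> (r (gen x)) = inv\<^bsub>?F\<^esub> gen x \<otimes>\<^bsub>?F\<^esub> inv\<^bsub>?F\<^esub> gen y"
        unfolding r(2) mult[OF \<kappa> gc[OF X(1)] gc[OF X(2)]] \<kappa>_gen[OF X(1)] \<kappa>_gen[OF X(2)]
        by (simp add: g_def)
      also have "\<dots> = l (?\<kappa> (gen x))"
        unfolding \<kappa>_gen[OF X(1)] using l(2) gc X by (simp add: g_def linv F.inv_mult_group)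
      finally show ?thesis using True by simp
    next
      case False
      then show ?thesis
        using k r(3)[of k] l(3)[of k] \<kappa>_gen[OF k] gc[OF k] by (auto simp: g_def linv)
    qed
    then show "(?\<kappa> \<otimes>\<^bsub>\<A>\<^esub> r) (gen k) = (l \<otimes>\<^bsub>\<A>\<^esub> ?\<kappa>) (gen k)"
      by (simp only: app[OF \<kappa> r(1) gc[OF k]] app[OF l(1) \<kappa> gc[OF k]])
  qed (use \<kappa> l(1) r(1) in auto)
  then show thesis using that \<kappa> by blast
qed

section \<open>Determinants on eigenspaces\<close>

text \<open>If \<open>m > d\<close>, pad both factors with zeros to \<open>m \<times> m\<close> matrices. The product does not change, but
  the padded \<open>C\<close> has a zero column and is singular.\<close>

lemma right_inverse_dim_le:
  fixes B C :: "'a::field mat"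
  assumes B: "B \<in> carrier_mat d m" and C: "C \<in> carrier_mat m d" and CB: "C * B = 1\<^sub>m m"
  shows "m \<le> d"
proof (rule ccontr)
  assume "\<not> m \<le> d"
  then have dm: "d < m" by simp
  let ?C = "mat m m (\<lambda>(i, j). if j < d then C $$ (i, j) else 0)"
  let ?B = "mat m m (\<lambda>(i, j). if i < d then B $$ (i, j) else 0)"
  have "?C * ?B = 1\<^sub>m m"
  proof (rule eq_matI)
    fix i j assume ij: "i < dim_row (1\<^sub>m m :: 'a mat)" "j < dim_col (1\<^sub>m m :: 'a mat)"
    have "(?C * ?B) $$ (i, j) = (\<Sum>k\<in>{0..<m}. if k < d then C $$ (i, k) * B $$ (k, j) else 0)"
      using ij by (auto simp: scalar_prod_def intro!: sum.cong)
    also have "\<dots> = (\<Sum>k\<in>{0..<d}. C $$ (i, k) * B $$ (k, j))"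
      using dm by (intro sum.mono_neutral_cong_right) auto
    also have "\<dots> = (C * B) $$ (i, j)"
      using ij B C by (auto simp: scalar_prod_def)
    finally show "(?C * ?B) $$ (i, j) = 1\<^sub>m m $$ (i, j)" by (simp add: CB)
  qed auto
  then have "det ?C * det ?B = 1"
    using det_mult[of ?C m ?B] by simp
  moreover have "?C *\<^sub>v unit_vec m d = 0\<^sub>v m"
    using dm by (intro eq_vecI) auto
  then have "det ?C = 0"
    using dm det_0_iff_vec_prod_zero_field[of ?C m] unit_vec_nonzero[of d m]
    by (auto intro!: exI[of _ "unit_vec m d"])
  ultimately show False by simp
qed

text \<open>The columns of \<open>B\<close> form a basis of the kernel of \<open>K\<close>, and the rows of \<open>C\<close> are coordinate
  functionals for it. The pair is chosen with \<open>m\<close> maximal subject to \<open>CB = 1\<close> and \<open>KB = 0\<close>. If the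
  columns did not span the kernel, some \<open>w \<noteq> 0\<close> in it would satisfy \<open>Cw = 0\<close>, and \<open>w\<close> together with
  a functional dual to it would enlarge the pair.\<close>

lemma kernel_splitting:
  fixes K :: "'a::field mat"
  assumes K: "K \<in> carrier_mat r d"
  obtains m B C where "B \<in> carrier_mat d m" "C \<in> carrier_mat m d" "C * B = 1\<^sub>m m"
    "K * B = 0\<^sub>m r m"
    "\<And>v. v \<in> carrier_vec d \<Longrightarrow> K *\<^sub>v v = 0\<^sub>v r \<Longrightarrow> B *\<^sub>v (C *\<^sub>v v) = v"
proof -
  define Q where "Q m = (\<exists>B C. B \<in> carrier_mat d m \<and> C \<in> carrier_mat m d \<and> C * B = 1\<^sub>m m \<and>
    K * B = 0\<^sub>m r m)" for m
  have "Q 0"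
    unfolding Q_def by (rule exI[of _ "0\<^sub>m d 0"], rule exI[of _ "0\<^sub>m 0 d"]) (use K in auto)
  moreover have bnd: "m \<le> d" if "Q m" for m
    using that right_inverse_dim_le unfolding Q_def by blast
  ultimately obtain m where Qm: "Q m" and max: "\<And>k. Q k \<Longrightarrow> k \<le> m"
    using Nat.ex_has_greatest_nat[of Q 0 d] by blast
  then obtain B C where BC: "B \<in> carrier_mat d m" "C \<in> carrier_mat m d" "C * B = 1\<^sub>m m"
    "K * B = 0\<^sub>m r m" unfolding Q_def by blast
  have "B *\<^sub>v (C *\<^sub>v v) = v" if v: "v \<in> carrier_vec d" and Kv: "K *\<^sub>v v = 0\<^sub>v r" for v
  proof (rule ccontr)
    assume neq: "B *\<^sub>v (C *\<^sub>v v) \<noteq> v"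
    define w where "w = v - B *\<^sub>v (C *\<^sub>v v)"
    have Cv: "C *\<^sub>v v \<in> carrier_vec m" and BCv: "B *\<^sub>v (C *\<^sub>v v) \<in> carrier_vec d"
      using BC v by auto
    have w: "w \<in> carrier_vec d" unfolding w_def using v BCv by (rule minus_carrier_vec)
    have "0\<^sub>m r m *\<^sub>v (C *\<^sub>v v) = 0\<^sub>v r" using Cv by (intro eq_vecI) auto
    then have "K *\<^sub>v (B *\<^sub>v (C *\<^sub>v v)) = 0\<^sub>v r"
      using assoc_mult_mat_vec[OF K BC(1) Cv] BC(4) by simp
    then have Kw: "K *\<^sub>v w = 0\<^sub>v r"
      using mult_minus_distrib_mat_vec[OF K v BCv] Kv by (simp add: w_def)
    have "C *\<^sub>v (B *\<^sub>v (C *\<^sub>v v)) = C *\<^sub>v v"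
      using assoc_mult_mat_vec[OF BC(2,1) Cv] BC(3) Cv by simp
    then have Cw: "C *\<^sub>v w = 0\<^sub>v m"
      using mult_minus_distrib_mat_vec[OF BC(2) v BCv] Cv by (simp add: w_def)
    have "w \<noteq> 0\<^sub>v d"
    proof
      assume w0: "w = 0\<^sub>v d"
      have "(B *\<^sub>v (C *\<^sub>v v)) $ i = v $ i" if "i < d" for i
        using arg_cong[OF w0, of "\<lambda>x. x $ i"] that v BC(1) by (simp add: w_def)
      then show False using neq v BC(1) by (auto intro!: eq_vecI)
    qed
    then obtain t where t: "t < d" "w $ t \<noteq> 0" using w by (metis carrier_vecD eq_vecI index_zero_vec)
    \<comment> \<open>the \<open>t\<close>-th coordinate functional, corrected to vanish on the columns of \<open>B\<close> and scaled
      to take the value 1 at \<open>w\<close>\<close>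
    define c where "c j = ((if j = t then 1 else 0) - (\<Sum>k<m. B $$ (t, k) * C $$ (k, j))) / w $ t" for j
    have CBe: "(\<Sum>j<d. C $$ (i, j) * B $$ (j, k)) = (if i = k then 1 else 0)"
      if "i < m" "k < m" for i k
      using arg_cong[OF BC(3), of "\<lambda>x. x $$ (i, k)"] that BC(1,2)
      by (simp add: scalar_prod_def atLeast0LessThan)
    have Cwe: "(\<Sum>j<d. C $$ (i, j) * w $ j) = 0" if "i < m" for i
      using arg_cong[OF Cw, of "\<lambda>x. x $ i"] that BC(2) w
      by (simp add: scalar_prod_def atLeast0LessThan)
    have gen: "(\<Sum>j<d. c j * g j) = (g t - (\<Sum>k<m. B $$ (t, k) * (\<Sum>j<d. C $$ (k, j) * g j))) / w $ t"
      for g :: "nat \<Rightarrow> 'a"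
    proof -
      have "(\<Sum>j<d. c j * g j) = (\<Sum>j<d. (if j = t then g j else 0)
          - (\<Sum>k<m. B $$ (t, k) * (C $$ (k, j) * g j))) / w $ t"
        unfolding sum_divide_distrib
        by (rule sum.cong)
          (simp_all add: c_def mult.assoc[symmetric] sum_distrib_right[symmetric] left_diff_distrib)
      also have "\<dots> = (g t - (\<Sum>j<d. \<Sum>k<m. B $$ (t, k) * (C $$ (k, j) * g j))) / w $ t"
        using t(1) by (simp add: sum_subtractf)
      also have "(\<Sum>j<d. \<Sum>k<m. B $$ (t, k) * (C $$ (k, j) * g j))
          = (\<Sum>k<m. B $$ (t, k) * (\<Sum>j<d. C $$ (k, j) * g j))"
        by (subst sum.swap) (simp add: sum_distrib_left)
      finally show ?thesis .
    qed
    have cB: "(\<Sum>j<d. c j * B $$ (j, k)) = 0" if "k < m" for k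
      using that by (simp add: gen CBe if_distrib[of "(*) _"] cong: if_cong)
    have cw: "(\<Sum>j<d. c j * w $ j) = 1"
      using t by (simp add: gen Cwe)
    let ?B = "mat d (Suc m) (\<lambda>(i, j). if j < m then B $$ (i, j) else w $ i)"
    let ?C = "mat (Suc m) d (\<lambda>(i, j). if i < m then C $$ (i, j) else c j)"
    have "?C * ?B = 1\<^sub>m (Suc m)"
      by (rule eq_matI)
        (auto simp: scalar_prod_def atLeast0LessThan CBe Cwe cB cw less_Suc_eq)
    moreover have "K * ?B = 0\<^sub>m r (Suc m)"
    proof (rule eq_matI)
      fix i j assume ij: "i < dim_row (0\<^sub>m r (Suc m) :: 'a mat)" "j < dim_col (0\<^sub>m r (Suc m) :: 'a mat)"
      show "(K * ?B) $$ (i, j) = 0\<^sub>m r (Suc m) $$ (i, j)"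
      proof (cases "j < m")
        case True
        then have "col ?B j = col B j" using BC(1) by (intro eq_vecI) auto
        then show ?thesis
          using arg_cong[OF BC(4), of "\<lambda>x. x $$ (i, j)"] ij True K BC(1) by simp
      next
        case False
        then have "col ?B j = w" using w ij by (intro eq_vecI) auto
        then show ?thesis
          using arg_cong[OF Kw, of "\<lambda>x. x $ i"] ij K by simp
      qed
    qed (use K in auto)
    ultimately have "Q (Suc m)"
      unfolding Q_def by (intro exI[of _ ?B] exI[of _ ?C]) auto
    then show False using max[of "Suc m"] by simp
  qed
  then show thesis using that BC by blast
qed

text \<open>The number \<open>m\<close> is the dimension of the eigenspace of \<open>\<mu>\<close>, and \<open>\<delta> N\<close> is the determinant of the
  restriction of \<open>N\<close> to it. With \<open>B\<close> and \<open>C\<close> a basis of the eigenspace and its coordinate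
  functionals, this is \<open>det (CNB)\<close>. Multiplicativity holds because \<open>N'\<close> commutes with \<open>M\<close>, so that \<open>N'B\<close> again has its columns in the
  eigenspace, so \<open>N'B = BCN'B\<close>.\<close>

lemma eigenspace_determinant:
  fixes M :: "'a::field mat"
  assumes M: "M \<in> carrier_mat d d" and ev: "eigenvalue M \<mu>"
  obtains \<delta> :: "'a mat \<Rightarrow> 'a" and m :: nat where "m > 0" "\<delta> M = \<mu> ^ m" "\<delta> (1\<^sub>m d) = 1"
    "\<And>N N'. N \<in> carrier_mat d d \<Longrightarrow> N' \<in> carrier_mat d d \<Longrightarrow> N * M = M * N \<Longrightarrow>
      N' * M = M * N' \<Longrightarrow> \<delta> (N * N') = \<delta> N * \<delta> N'"
proof -
  define K where "K = char_matrix M \<mu>"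
  have K: "K \<in> carrier_mat d d" using M by (simp add: K_def)
  have eig: "M *\<^sub>v v = \<mu> \<cdot>\<^sub>v v \<longleftrightarrow> K *\<^sub>v v = 0\<^sub>v d" if v: "v \<in> carrier_vec d" for v
  proof (cases "v = 0\<^sub>v d")
    case True
    then show ?thesis using M K by (auto intro!: eq_vecI)
  next
    case False
    then show ?thesis
      using eigenvector_char_matrix[OF M, of v \<mu>] v M by (simp add: K_def eigenvector_def)
  qed
  obtain m B C where B: "B \<in> carrier_mat d m" and C: "C \<in> carrier_mat m d"
    and CB: "C * B = 1\<^sub>m m" and KB: "K * B = 0\<^sub>m d m"
    and ker: "\<And>v. v \<in> carrier_vec d \<Longrightarrow> K *\<^sub>v v = 0\<^sub>v d \<Longrightarrow> B *\<^sub>v (C *\<^sub>v v) = v"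
    using kernel_splitting[OF K] by metis
  have MB: "M * B = \<mu> \<cdot>\<^sub>m B"
  proof (rule mat_col_eqI)
    fix j assume "j < dim_col (\<mu> \<cdot>\<^sub>m B)"
    then have j: "j < m" using B by simp
    have c: "col B j \<in> carrier_vec d" using B by auto
    have "K *\<^sub>v col B j = 0\<^sub>v d"
      using col_mult2[OF K B j] KB j by simp
    then have "M *\<^sub>v col B j = \<mu> \<cdot>\<^sub>v col B j" using eig[OF c] by simp
    then show "col (M * B) j = col (\<mu> \<cdot>\<^sub>m B) j"
      using col_mult2[OF M B j] j B by simp
  qed (use M B in auto)
  have range: "B * (C * (N * B)) = N * B"
    if N: "N \<in> carrier_mat d d" and comm: "N * M = M * N" for N
  proof -
    have NB: "N * B \<in> carrier_mat d m" using N B by auto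
    have MNB: "M * (N * B) = \<mu> \<cdot>\<^sub>m (N * B)"
      using assoc_mult_mat[OF M N B] assoc_mult_mat[OF N M B] comm MB mult_smult_distrib[OF N B]
      by simp
    then have "M *\<^sub>v col (N * B) j = \<mu> \<cdot>\<^sub>v col (N * B) j" if "j < m" for j
      using col_mult2[OF M NB that] that NB B by (simp add: MNB)
    then have "K *\<^sub>v col (N * B) j = 0\<^sub>v d" if "j < m" for j
      using eig[of "col (N * B) j"] that NB by auto
    then have *: "B *\<^sub>v (C *\<^sub>v col (N * B) j) = col (N * B) j" if "j < m" for j
      using ker[of "col (N * B) j"] that NB by auto
    show ?thesis
    proof (rule mat_col_eqI)
      fix j assume "j < dim_col (N * B)"
      then have j: "j < m" using B by simp
      have CNB: "C * (N * B) \<in> carrier_mat m m" using C NB by auto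
      show "col (B * (C * (N * B))) j = col (N * B) j"
        using *[OF j] col_mult2[OF B CNB j] col_mult2[OF C NB j] by simp
    qed (use N B in auto)
  qed
  define \<delta> where "\<delta> N = det (C * (N * B))" for N
  show thesis
  proof (rule that[of m \<delta>])
    obtain v where v: "v \<in> carrier_vec d" "v \<noteq> 0\<^sub>v d" "M *\<^sub>v v = \<mu> \<cdot>\<^sub>v v"
      using ev M unfolding eigenvalue_def eigenvector_def by auto
    have "K *\<^sub>v v = 0\<^sub>v d" using eig[OF v(1)] v by simp
    then have BCv: "B *\<^sub>v (C *\<^sub>v v) = v" using ker v by simp
    show "m > 0"
    proof (rule ccontr)
      assume "\<not> m > 0"
      then have "B *\<^sub>v (C *\<^sub>v v) = 0\<^sub>v d" using B C by (intro eq_vecI) (auto simp: scalar_prod_def)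
      then show False using BCv v by simp
    qed
    show "\<delta> M = \<mu> ^ m"
      using MB mult_smult_distrib[OF C B, of \<mu>] CB by (simp add: \<delta>_def)
    show "\<delta> (1\<^sub>m d) = 1" using B CB by (simp add: \<delta>_def)
    fix N N' :: "'a mat"
    assume N: "N \<in> carrier_mat d d" "N' \<in> carrier_mat d d" "N * M = M * N" "N' * M = M * N'"
    have carr: "N' * B \<in> carrier_mat d m" "C * (N' * B) \<in> carrier_mat m m"
      "N * B \<in> carrier_mat d m" "C * (N * B) \<in> carrier_mat m m" using N B C by auto
    have "C * (N * N' * B) = C * (N * (B * (C * (N' * B))))"
      using range[OF N(2,4)] assoc_mult_mat[OF N(1,2) B] by simp
    also have "\<dots> = C * (N * B) * (C * (N' * B))"
      using assoc_mult_mat[OF N(1) B carr(2)] assoc_mult_mat[OF C carr(3,2)] by simp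
    finally show "\<delta> (N * N') = \<delta> N * \<delta> N'"
      using det_mult[OF carr(4,2)] by (simp add: \<delta>_def)
  qed
qed

section \<open>Eigenvalues of transvections\<close>

text \<open>The image of the identity is an idempotent matrix of determinant 1.\<close>

lemma hom_SL_one:
  assumes G: "group G" and \<Phi>: "\<Phi> \<in> hom G (SL d)"
  shows "\<Phi> \<one>\<^bsub>G\<^esub> = 1\<^sub>m d"
proof -
  interpret group G by (rule G)
  define E where "E = \<Phi> \<one>\<^bsub>G\<^esub>"
  have E: "E \<in> carrier_mat d d" "det E = 1" and EE: "E * E = E"
    using hom_in_carrier[OF \<Phi>, of "\<one>\<^bsub>G\<^esub>"] hom_mult[OF \<Phi>, of "\<one>\<^bsub>G\<^esub>" "\<one>\<^bsub>G\<^esub>"]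
    by (auto simp: E_def SL_def)
  have adj: "adj_mat E \<in> carrier_mat d d" "adj_mat E * E = 1\<^sub>m d" using adj_mat[OF E(1)] E(2) by auto
  have "E = adj_mat E * E * E" using adj E by simp
  also have "\<dots> = 1\<^sub>m d" using assoc_mult_mat[OF adj(1) E(1) E(1)] EE adj(2) by simp
  finally show ?thesis by (simp add: E_def)
qed

lemma eigenvalue_left_transvection:
  fixes X :: "'a set" and \<Phi> :: "_ \<Rightarrow> 'k::field mat"
  defines "\<A> \<equiv> AutoGroup (free_group X)"
  assumes "{x, y, z, u} \<subseteq> X" and "distinct [x, y, z, u]"
    and l: "l \<in> carrier \<A>" "l (gen x) = gen y \<otimes>\<^bsub>free_group X\<^esub> gen x"
      "\<And>k. k \<in> X - {x} \<Longrightarrow> l (gen k) = gen k"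
    and carr: "\<And>f. f \<in> carrier \<A> \<Longrightarrow> \<Phi> f \<in> carrier_mat d d"
    and mult: "\<And>f g. f \<in> carrier \<A> \<Longrightarrow> g \<in> carrier \<A> \<Longrightarrow> \<Phi> (f \<otimes>\<^bsub>\<A>\<^esub> g) = \<Phi> f * \<Phi> g"
    and one: "\<Phi> \<one>\<^bsub>\<A>\<^esub> = 1\<^sub>m d"
    and ev: "eigenvalue (\<Phi> l) \<mu>"
  obtains m where "m > 0" "\<mu> ^ m = 1"
proof -
  obtain \<delta> m where m: "m > 0" "\<delta> (\<Phi> l) = \<mu> ^ m" "\<delta> (1\<^sub>m d) = 1"
    and \<delta>: "\<And>N N'. N \<in> carrier_mat d d \<Longrightarrow> N' \<in> carrier_mat d d \<Longrightarrow> N * \<Phi> l = \<Phi> l * N \<Longrightarrow>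
      N' * \<Phi> l = \<Phi> l * N' \<Longrightarrow> \<delta> (N * N') = \<delta> N * \<delta> N'"
    using eigenspace_determinant[OF carr[OF l(1)] ev] by metis
  have comm: "\<Phi> f * \<Phi> l = \<Phi> l * \<Phi> f"
    if "f \<in> carrier \<A>" "f \<otimes>\<^bsub>\<A>\<^esub> l = l \<otimes>\<^bsub>\<A>\<^esub> f" for f
    using that l(1) mult by metis
  have "\<delta> (\<Phi> l) = 1"
    by (rule transvection_character_trivial[of x y z u X l "\<lambda>f. \<delta> (\<Phi> f)", folded \<A>_def])
      (use assms(2,3) l one m(3) in \<open>auto simp: mult \<delta> carr comm\<close>)
  then show thesis using that m by simp
qed

theorem corollary8p3:
  fixes n d :: nat
    and lam :: "nat letter list \<Rightarrow> nat letter list"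
    and \<Phi> :: "(nat letter list \<Rightarrow> nat letter list) \<Rightarrow> real mat"
  assumes "n \<ge> 6"
    and "nielsen n lam"
    and "\<Phi> \<in> hom (AutoGroup (Fn n)) (SL d)"
  shows "\<forall>\<mu>::complex. eigenvalue (map_mat complex_of_real (\<Phi> lam)) \<mu> \<longrightarrow> cmod \<mu> = 1"
proof (intro allI impI)
  fix \<mu> :: complex
  assume ev: "eigenvalue (map_mat complex_of_real (\<Phi> lam)) \<mu>"
  interpret A: group "AutoGroup (Fn n)" by (rule group.AutoGroup[OF group_free_group])
  let ?A = "AutoGroup (Fn n)"
  define H where "H f = map_mat complex_of_real (\<Phi> f)" for f
  have \<Phi>: "\<Phi> f \<in> carrier_mat d d" if "f \<in> carrier ?A" for f
    using hom_in_carrier[OF assms(3) that] by (simp add: SL_def)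
  have carr: "H f \<in> carrier_mat d d" if "f \<in> carrier ?A" for f
    using \<Phi>[OF that] by (simp add: H_def)
  have mult: "H (f \<otimes>\<^bsub>?A\<^esub> g) = H f * H g" if "f \<in> carrier ?A" "g \<in> carrier ?A" for f g
    using hom_mult[OF assms(3) that] of_real_hom.mat_hom_mult[OF \<Phi>[OF that(1)] \<Phi>[OF that(2)]]
    by (simp add: H_def SL_def)
  have one: "H \<one>\<^bsub>?A\<^esub> = 1\<^sub>m d"
    using hom_SL_one[OF A.group_axioms assms(3)] by (simp add: H_def of_real_hom.mat_hom_one)
  obtain i j where ij: "i \<in> {1..n}" "j \<in> {1..n}" "i \<noteq> j"
    and lam: "is_left_nielsen n i j lam \<or> is_right_nielsen n i j lam"
    using assms(2) unfolding nielsen_def by blast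
  obtain l where l: "is_left_nielsen n i j l" using ex_left_nielsen[OF ij] by blast
  note l' = l[unfolded is_left_nielsen_def]
  have ev_l: "eigenvalue (H l) \<mu>"
    using lam
  proof
    assume "is_left_nielsen n i j lam"
    note lam' = this[unfolded is_left_nielsen_def]
    have "lam (gen k) = l (gen k)" if "k \<in> {1..n}" for k
      using that l' lam' by (cases "k = i") simp_all
    then have "lam = l" using l' lam' free_AutoGroup_eqI by blast
    then show ?thesis using ev by (simp add: H_def)
  next
    assume r: "is_right_nielsen n i j lam"
    note r' = r[unfolded is_right_nielsen_def]
    obtain \<kappa> where \<kappa>: "\<kappa> \<in> carrier ?A" "\<kappa> \<otimes>\<^bsub>?A\<^esub> lam = l \<otimes>\<^bsub>?A\<^esub> \<kappa>"
      using right_transvection_conjugate_left[of i "{1..n}" j l lam] ij l' r' by blast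
    then have "lam = inv\<^bsub>?A\<^esub> \<kappa> \<otimes>\<^bsub>?A\<^esub> l \<otimes>\<^bsub>?A\<^esub> \<kappa>"
      using l' r' by (metis A.inv_closed A.inv_solve_left A.m_assoc A.m_closed)
    then have conj: "H lam = H (inv\<^bsub>?A\<^esub> \<kappa>) * H l * H \<kappa>"
      using \<kappa> l' mult by (simp del: One_nat_def)
    have \<kappa>': "inv\<^bsub>?A\<^esub> \<kappa> \<in> carrier ?A" using \<kappa>(1) by (rule A.inv_closed)
    have "similar_mat (H lam) (H l)"
    proof (rule similar_matI[OF _ _ _ conj])
      show "{H lam, H l, H (inv\<^bsub>?A\<^esub> \<kappa>), H \<kappa>} \<subseteq> carrier_mat d d"
        using carr \<kappa>(1) \<kappa>' l' r' by blast
      show "H (inv\<^bsub>?A\<^esub> \<kappa>) * H \<kappa> = 1\<^sub>m d" "H \<kappa> * H (inv\<^bsub>?A\<^esub> \<kappa>) = 1\<^sub>m d"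
        using mult[OF \<kappa>(1) \<kappa>'] mult[OF \<kappa>' \<kappa>(1)] A.l_inv[OF \<kappa>(1)] A.r_inv[OF \<kappa>(1)] one by metis+
    qed
    then have "char_poly (H lam) = char_poly (H l)" by (rule char_poly_similar)
    then show ?thesis
      using ev eigenvalue_root_char_poly[OF carr] l' r' by (simp add: H_def del: One_nat_def)
  qed
  obtain z u where zu: "z \<in> {1..n}" "u \<in> {1..n}" "distinct [i, j, z, u]"
  proof -
    have "card ({1..n} - {i, j}) \<ge> 2"
      using assms(1) ij by (simp add: card_Diff_subset)
    then obtain S where "S \<subseteq> {1..n} - {i, j}" "card S = 2" by (meson obtain_subset_with_card_n)
    then show thesis using that ij by (auto simp: card_2_iff)
  qed
  have "{i, j, z, u} \<subseteq> {1..n}" using ij zu by blast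
  then obtain m where "m > 0" "\<mu> ^ m = 1"
    using eigenvalue_left_transvection[OF _ zu(3), of "{1..n}" l H d \<mu>] l' carr mult one ev_l
    by blast
  then show "cmod \<mu> = 1"
    by (metis norm_ge_zero norm_one norm_power power_eq_1_iff neq0_conv)
qed

end
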